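(* Let $G$ be a finite simple graph on $n$ vertices, let $\mathbf z$ be an eigenvector of its adjacency matrix $A(G)$ corresponding to $\lambda_2(G)$, and let $V_+=\{w\in V(G):\mathbf z_w>0\}$ and $V_-=\{w\in V(G):\mathbf z_w<0\}$. Suppose that $u\in V_+$, $v\in V_-$ and $uv$ is an edge of $G$. Then $\lambda_2(G-uv)>\lambda_2(G)$.
   Context: For a graph $G$ on $n$ vertices, $\lambda_1(G)\ge\lambda_2(G)\ge\cdots\ge\lambda_n(G)$ are the eigenvalues of its adjacency matrix $A(G)$, listed with multiplicity. $G-uv$ denotes the graph obtained from $G$ by deleting the edge $uv$ (keeping all vertices). *)

theory Defs
  imports "HOL-Analysis.Analysis" "HOL-Computational_Algebra.Polynomial"
begin

text \<open>
  A finite simple graph is given by its edge set; its vertex set is the whole of the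
  (arbitrary) finite type \<open>'v\<close>, so that it has \<open>CARD('v)\<close> vertices. In particular, removing an
  element of the edge set keeps all vertices.
\<close>

definition simple_graph :: "'v::finite set set \<Rightarrow> bool" where
  "simple_graph E \<longleftrightarrow> (\<forall>e\<in>E. card e = 2)"

definition delete_edge :: "'v::finite set set \<Rightarrow> 'v \<Rightarrow> 'v \<Rightarrow> 'v set set" where
  "delete_edge E u v = E - {{u, v}}"

definition adjacency_matrix :: "'v::finite set set \<Rightarrow> real^'v^'v" where
  "adjacency_matrix E = (\<chi> i j. if {i, j} \<in> E then 1 else 0)"

definition is_eigenvector :: "real^'n^'n \<Rightarrow> real^'n \<Rightarrow> real \<Rightarrow> bool" where
  "is_eigenvector A x c \<longleftrightarrow> x \<noteq> 0 \<and> A *v x = c *\<^sub>R x"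

text \<open>The determinant is taken over the polynomial ring; \<open>[:0, 1:]\<close> is the indeterminate.\<close>

definition characteristic_polynomial :: "'a::comm_ring_1^'n^'n \<Rightarrow> 'a poly" where
  "characteristic_polynomial A = det (mat [:0, 1:] - map_matrix (\<lambda>c. [:c:]) A)"

text \<open>
  The real eigenvalues in weakly decreasing order, each repeated according to its multiplicity
  as a root of the characteristic polynomial. For a symmetric \<open>n \<times> n\<close> matrix this list has
  exactly \<open>n\<close> entries.
\<close>

definition eigenvalue_list :: "real^'n^'n \<Rightarrow> real list" where
  "eigenvalue_list A = rev (sorted_list_of_multiset (proots (characteristic_polynomial A)))"

text \<open>
  \<open>graph_eigenvalue k E\<close> is \<open>\<lambda>\<^sub>k\<close>, meaningful for \<open>1 \<le> k \<le> CARD('v)\<close>; the shift accounts for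
  list positions starting at 0.
\<close>

definition graph_eigenvalue :: "nat \<Rightarrow> 'v::finite set set \<Rightarrow> real" where
  "graph_eigenvalue k E = eigenvalue_list (adjacency_matrix E) ! (k - 1)"

end

theory Submission
  imports Defs
begin

text \<open>
  Write \<open>z = p - q\<close> with \<open>p, q\<close> the positive and negative parts of the eigenvector, and put
  \<open>s = p \<bullet> A q\<close>, \<open>d = p\<^sub>u q\<^sub>v\<close>, so that \<open>0 < d \<le> s\<close>. The eigenvalue equation gives
  \<open>p \<bullet> A p = s + \<lambda>\<^sub>2 |p|\<^sup>2\<close> and \<open>q \<bullet> A q = s + \<lambda>\<^sub>2 |q|\<^sup>2\<close>; deleting \<open>uv\<close> changes neither value and
  lowers the mixed term from \<open>s\<close> to \<open>s - d\<close>. Hence on the plane spanned by \<open>p\<close> and \<open>q\<close> the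
  quadratic form of the new adjacency matrix minus \<open>\<lambda>\<^sub>2\<close> is
  \<open>d (a\<^sup>2 + b\<^sup>2) + (s - d) (a + b)\<^sup>2\<close>, which is positive definite, and the Courant--Fischer
  principle yields a second eigenvalue above \<open>\<lambda>\<^sub>2\<close>.
\<close>

section \<open>Order statistics of multisets\<close>

text \<open>Counting argument: if the entry at position 1 of the decreasing list were at most
  \<open>c\<close>, only the head could exceed \<open>c\<close>, whereas \<open>a\<close> and
  \<open>b\<close> contribute two such elements, even when they are equal.\<close>

lemma second_largest_gt:
  fixes M :: "'a::linorder multiset"
  assumes sub: "{#a, b#} \<subseteq># M" and "a > c" "b > c"
  shows "rev (sorted_list_of_multiset M) ! 1 > c"
proof -
  define l where "l = rev (sorted_list_of_multiset M)"
  have M: "mset l = M"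
    by (simp add: l_def)
  have sorted: "sorted_wrt (\<ge>) l"
    by (simp add: l_def sorted_wrt_rev)
  have "size M \<ge> 2"
    using size_mset_mono[OF sub] by simp
  then have "length l \<ge> 2"
    using M by auto
  then obtain x y ys where l: "l = x # y # ys"
    by (metis Suc_le_length_iff numeral_2_eq_2)
  have "y > c"
  proof (rule ccontr)
    assume "\<not> y > c"
    then have *: "\<forall>w \<in> set (y # ys). \<not> w > c"
      using sorted l by auto
    have "size (filter_mset (\<lambda>w. w > c) {#a, b#}) \<le> size (filter_mset (\<lambda>w. w > c) M)"
      by (intro size_mset_mono multiset_filter_mono sub)
    also have "\<dots> = length (filter (\<lambda>w. w > c) l)"
      unfolding M[symmetric] by (metis mset_filter size_mset)
    also have "filter (\<lambda>w. w > c) (y # ys) = []"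
      using * by (simp only: filter_empty_conv)
    then have "length (filter (\<lambda>w. w > c) l) \<le> 1"
      unfolding l by (subst filter.simps) simp
    finally show False
      using assms by simp
  qed
  then show ?thesis
    using l by (simp add: l_def)
qed

section \<open>Rayleigh quotients on invariant subspaces\<close>

text \<open>By compactness the Rayleigh quotient attains its maximum on the unit sphere of
  \<open>S\<close>; a maximiser is an eigenvector because its residual stays in the invariant space
  \<open>S\<close> and is thus an admissible direction. A general \<open>S\<close> allows a second
  application on an orthogonal complement.\<close>

lemma self_adjoint_max_eigenvector:
  fixes T :: "'a::euclidean_space \<Rightarrow> 'a"
  assumes lin: "linear T" and sym: "\<And>x y. x \<bullet> T y = T x \<bullet> y"
    and S: "subspace S" "T ` S \<subseteq> S" "S \<noteq> {0}"
  obtains x \<mu> where "x \<in> S" "x \<noteq> 0" "T x = \<mu> *\<^sub>R x" "\<And>y. y \<in> S \<Longrightarrow> y \<bullet> T y \<le> \<mu> * (y \<bullet> y)"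
proof -
  define K where "K = S \<inter> sphere 0 1"
  have "compact K"
    unfolding K_def using closed_subspace[OF S(1)] compact_sphere by (simp add: closed_Int_compact)
  moreover have in_K: "(1 / norm y) *\<^sub>R y \<in> K" if "y \<in> S" "y \<noteq> 0" for y
    using that S(1) by (simp add: K_def subspace_scale)
  obtain y0 where "y0 \<in> S" "y0 \<noteq> 0"
    using S subspace_0 by blast
  with in_K have "K \<noteq> {}"
    by blast
  moreover have "continuous_on K (\<lambda>y. y \<bullet> T y)"
    using lin by (intro continuous_intros linear_continuous_on) (simp add: linear_conv_bounded_linear)
  ultimately obtain x where x: "x \<in> K" and max: "\<And>y. y \<in> K \<Longrightarrow> y \<bullet> T y \<le> x \<bullet> T x"
    using continuous_attains_sup[of K "\<lambda>y. y \<bullet> T y"] by blast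
  define \<mu> where "\<mu> = x \<bullet> T x"
  have xS: "x \<in> S" and xx: "x \<bullet> x = 1"
    using x by (auto simp: K_def norm_eq_1)
  have bound: "y \<bullet> T y \<le> \<mu> * (y \<bullet> y)" if "y \<in> S" for y
  proof (cases "y = 0")
    case False
    have "(1 / norm y)\<^sup>2 * (y \<bullet> T y) \<le> \<mu>"
      using max[OF in_K[OF that False]]
      by (simp add: \<mu>_def linear_scale[OF lin] power2_eq_square)
    then have "y \<bullet> T y \<le> \<mu> * (norm y)\<^sup>2"
      using False by (simp add: power_divide field_simps)
    then show ?thesis
      by (simp add: dot_square_norm)
  qed simp
  define y where "y = T x - \<mu> *\<^sub>R x"
  have yS: "y \<in> S"
    using S xS by (auto simp: y_def intro!: subspace_diff subspace_scale)
  define a where "a = \<mu> * (y \<bullet> y) - y \<bullet> T y"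
  \<comment> \<open>First variation: the maximum of the Rayleigh quotient along the line through \<open>x\<close> in
    direction \<open>y\<close> is attained at \<open>x\<close>.\<close>
  have var: "2 * t * (y \<bullet> y) \<le> t\<^sup>2 * a" for t
  proof -
    have le: "(x + t *\<^sub>R y) \<bullet> T (x + t *\<^sub>R y) \<le> \<mu> * ((x + t *\<^sub>R y) \<bullet> (x + t *\<^sub>R y))"
      using S xS yS by (intro bound subspace_add subspace_scale) auto
    have form: "(x + t *\<^sub>R y) \<bullet> T (x + t *\<^sub>R y) = \<mu> + 2 * t * (y \<bullet> T x) + t\<^sup>2 * (y \<bullet> T y)"
      using sym[of x y] by (simp add: \<mu>_def linear_add[OF lin] linear_scale[OF lin] inner_add_left
          inner_add_right inner_commute power2_eq_square algebra_simps)
    have norm: "(x + t *\<^sub>R y) \<bullet> (x + t *\<^sub>R y) = 1 + 2 * t * (y \<bullet> x) + t\<^sup>2 * (y \<bullet> y)"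
      by (simp add: inner_add_left inner_add_right xx inner_commute power2_eq_square algebra_simps)
    \<comment> \<open>Expanding only one factor identifies the difference of the linear coefficients
      in \<open>form\<close> and \<open>norm\<close> with the squared length of the
      residual.\<close>
    have yy: "y \<bullet> y = y \<bullet> T x - \<mu> * (y \<bullet> x)"
      by (subst (2) y_def) (simp add: inner_diff_right)
    have "2 * t * (y \<bullet> y) = 2 * t * (y \<bullet> T x) - \<mu> * (2 * t * (y \<bullet> x))"
      by (subst yy) (simp add: algebra_simps)
    then show ?thesis
      using le unfolding form norm a_def by (simp add: algebra_simps)
  qed
  have "y \<bullet> y \<le> 0"
  proof (rule ccontr)
    assume pos: "\<not> y \<bullet> y \<le> 0"
    \<comment> \<open>Small enough that the quadratic term cannot compensate the linear one; the
      summand 1 keeps the denominator positive.\<close>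
    define t where "t = (y \<bullet> y) / (\<bar>a\<bar> + 1)"
    have "t > 0"
      unfolding t_def using pos by (intro divide_pos_pos) linarith+
    with var[of t] have "2 * (y \<bullet> y) \<le> t * a"
      by (simp add: power2_eq_square)
    also have "\<dots> \<le> t * (\<bar>a\<bar> + 1)"
      using \<open>t > 0\<close> by (intro mult_left_mono) auto
    also have "\<dots> = y \<bullet> y"
      by (simp add: t_def)
    finally show False
      using pos by simp
  qed
  then have "y = 0"
    by (metis inner_gt_zero_iff not_le)
  then have "T x = \<mu> *\<^sub>R x"
    by (simp add: y_def)
  moreover have "x \<noteq> 0"
    using xx by auto
  ultimately show ?thesis
    using that xS bound by blast
qed


section \<open>Determinants and the characteristic polynomial\<close>

text \<open>The Leibniz formula uses only ring operations. This serves both evaluation of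
  polynomials at a point and the embedding of constants into polynomials.\<close>

lemma det_map_matrix_hom:
  fixes h :: "'a::comm_ring_1 \<Rightarrow> 'b::comm_ring_1"
  assumes one: "h 1 = 1" and add: "\<And>x y. h (x + y) = h x + h y"
    and mult: "\<And>x y. h (x * y) = h x * h y"
  shows "det (map_matrix h A) = h (det A)"
proof -
  have zero: "h 0 = 0"
    using add[of 0 0] by simp
  have minus: "h (- x) = - h x" for x
    using add[of x "- x"] by (simp add: zero eq_neg_iff_add_eq_0 add.commute)
  have sum: "h (sum f S) = (\<Sum>x\<in>S. h (f x))" for f and S :: "'z set"
    by (induction S rule: infinite_finite_induct) (auto simp: zero add)
  have prod: "h (prod f S) = (\<Prod>x\<in>S. h (f x))" for f and S :: "'z set"
    by (induction S rule: infinite_finite_induct) (auto simp: one mult)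
  have sign: "h (of_int (sign p)) = of_int (sign p)" for p :: "'c \<Rightarrow> 'c"
    by (cases p rule: sign_cases) (auto simp: one minus)
  show ?thesis
    by (simp add: det_def sum mult prod sign)
qed

lemma poly_characteristic_polynomial:
  fixes A :: "real^'n^'n"
  shows "poly (characteristic_polynomial A) t = det (mat t - A)"
proof -
  have "map_matrix (\<lambda>p. poly p t) (mat [:0, 1:] - map_matrix (\<lambda>c. [:c:]) A) = mat t - A"
    by (simp add: vec_eq_iff mat_def)
  then show ?thesis
    unfolding characteristic_polynomial_def by (subst det_map_matrix_hom[symmetric]) auto
qed

text \<open>Extend \<open>{x, y}\<close> to a basis and enumerate it by the row indices.\<close>

lemma obtain_matrix_with_rows:
  fixes x y :: "real^'n"
  assumes ind: "independent {x, y}" and ne: "x \<noteq> y"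
  obtains P :: "real^'n^'n" and i j where "det P \<noteq> 0" "i \<noteq> j" "P $ i = x" "P $ j = y"
proof -
  define B where "B = extend_basis {x, y}"
  have B: "{x, y} \<subseteq> B" "independent B" "span B = UNIV"
    using extend_basis_superset[OF ind] independent_extend_basis[OF ind] span_extend_basis[OF ind]
    by (auto simp: B_def)
  have "finite B" "card B = CARD('n)"
    using B independent_imp_finite dim_span[of B] dim_eq_card_independent[of B] by auto
  then obtain f :: "'n \<Rightarrow> real^'n" where f: "bij_betw f UNIV B"
    by (metis finite finite_same_card_bij)
  define P :: "real^'n^'n" where "P = (\<chi> i. f i)"
  have row: "row i P = f i" for i
    by (simp add: P_def row_def vec_eq_iff)
  have "rows P = B"
    using f by (auto simp: rows_def row bij_betw_def)
  then have "invertible P"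
    using B matrix_left_invertible_span_rows[of P] invertible_left_inverse by blast
  then have "det P \<noteq> 0"
    by (simp add: invertible_det_nz)
  moreover obtain i j where "f i = x" "f j = y"
    using f B(1) unfolding bij_betw_def by (metis insert_subset imageE)
  ultimately show ?thesis
    using that[of P i j] ne by (auto simp: P_def)
qed

text \<open>
  The case \<open>a = b\<close> is what relates the multiplicity as a root to the eigenspace: multiplying
  \<open>X - A\<close> from the left by an invertible constant matrix with rows \<open>x\<close> and \<open>y\<close> makes \<open>X - a\<close>
  and \<open>X - b\<close> factors of two different rows.
\<close>
lemma linear_factors_dvd_characteristic_polynomial:
  fixes A :: "real^'n^'n"
  assumes ind: "independent {x, y}" "x \<noteq> y"
    and x: "x v* A = a *\<^sub>R x" and y: "y v* A = b *\<^sub>R y"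
  shows "[:- a, 1:] * [:- b, 1:] dvd characteristic_polynomial A"
proof -
  obtain P :: "real^'n^'n" and i j
    where P: "det P \<noteq> 0" and ij: "i \<noteq> j" and rows: "P $ i = x" "P $ j = y"
    using obtain_matrix_with_rows[OF ind] .
  define C where "C = map_matrix (\<lambda>c::real. [:c:]) P"
  define M where "M = mat [:0, 1:] - map_matrix (\<lambda>c. [:c:]) A"
  define Q where "Q = C ** M"
  \<comment> \<open>Row \<open>k\<close> of the product is \<open>X\<close> times the row of
    \<open>P\<close> minus its image under \<open>A\<close>, so a left eigenvector turns it into a
    linear factor times a constant row.\<close>
  have entry: "Q $ k $ m = [:0, P $ k $ m:] - [:(P $ k v* A) $ m:]" for k m
  proof -
    have const: "(\<Sum>i\<in>S. [:f i:]) = [:sum f S:]" for f :: "'n \<Rightarrow> real" and S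
      by (induction S rule: infinite_finite_induct) auto
    have "Q $ k $ m = (\<Sum>l\<in>UNIV. (if l = m then [:0, P $ k $ l:] else 0) - [:A $ l $ m * P $ k $ l:])"
      unfolding Q_def C_def M_def matrix_matrix_mult_def
      by (auto simp: mat_def right_diff_distrib intro!: sum.cong)
    then show ?thesis
      by (simp add: sum_subtractf const vector_matrix_mult_def mult.commute)
  qed
  define r where "r z = (\<chi> m. [:z $ m:])" for z :: "real^'n"
  have row: "Q $ i = [:- a, 1:] *s r x" "Q $ j = [:- b, 1:] *s r y"
    by (simp_all add: vec_eq_iff entry rows x y r_def)
  have "det Q = det (\<chi> k. if k = i then [:- a, 1:] *s r x else Q $ k)"
    by (rule arg_cong[of _ _ det]) (simp add: vec_eq_iff row)
  also have "\<dots> = [:- a, 1:] * det (\<chi> k. if k = i then r x else Q $ k)"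
    by (rule det_row_mul)
  also have "(\<chi> k. if k = i then r x else Q $ k) =
      (\<chi> k. if k = j then [:- b, 1:] *s r y else if k = i then r x else Q $ k)"
    using ij by (simp add: vec_eq_iff row)
  also have "det \<dots> = [:- b, 1:] * det (\<chi> k. if k = j then r y else if k = i then r x else Q $ k)"
    by (rule det_row_mul)
  finally have "[:- a, 1:] * [:- b, 1:] dvd det Q"
    by (simp only: mult.assoc[symmetric] dvd_triv_left)
  \<comment> \<open>A nonzero constant is a unit among real polynomials, so divisibility passes to
    the characteristic polynomial.\<close>
  moreover have "det Q = [:det P:] * characteristic_polynomial A"
    unfolding Q_def C_def M_def det_mul characteristic_polynomial_def
    by (subst det_map_matrix_hom) (auto simp: one_pCons)
  ultimately show ?thesis
    using P by (simp add: dvd_smult_iff)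
qed

section \<open>Courant-Fischer for the second eigenvalue\<close>

text \<open>The plane of \<open>p\<close> and \<open>q\<close> meets the orthogonal complement of a
  top eigenvector in some \<open>w \<noteq> 0\<close>. Testing with \<open>w\<close> shows that both
  the global maximum of the Rayleigh quotient and its maximum on that complement exceed
  \<open>c\<close>.\<close>

lemma second_eigenvalue_gt:
  fixes A :: "real^'n^'n"
  assumes sym: "transpose A = A"
    and pos: "\<And>a b. a \<noteq> 0 \<or> b \<noteq> 0 \<Longrightarrow>
      (a *\<^sub>R p + b *\<^sub>R q) \<bullet> (A *v (a *\<^sub>R p + b *\<^sub>R q)) >
        c * ((a *\<^sub>R p + b *\<^sub>R q) \<bullet> (a *\<^sub>R p + b *\<^sub>R q))"
  shows "eigenvalue_list A ! 1 > c"
proof -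
  have vA: "x v* A = A *v x" for x
    using transpose_matrix_vector[of A x] by (simp add: sym)
  have adj: "x \<bullet> (A *v y) = (A *v x) \<bullet> y" for x y
    using dot_lmul_matrix[of x A y] by (simp add: vA)
  \<comment> \<open>The strict inequality in \<open>pos\<close> fails at the zero vector, so
    \<open>p\<close> and \<open>q\<close> are linearly independent.\<close>
  have nz: "a *\<^sub>R p + b *\<^sub>R q \<noteq> 0" if "a \<noteq> 0 \<or> b \<noteq> 0" for a b
    using pos[OF that] by fastforce
  have lin: "linear ((*v) A)"
    by simp
  have "p \<noteq> 0"
    using nz[of 1 0] by simp
  then have "(UNIV :: (real^'n) set) \<noteq> {0}"
    by blast
  then obtain x \<mu> where x: "x \<noteq> 0" "A *v x = \<mu> *\<^sub>R x"
    and x_max: "\<And>y. y \<bullet> (A *v y) \<le> \<mu> * (y \<bullet> y)"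
    using self_adjoint_max_eigenvector[OF lin adj subspace_UNIV] by auto
  define S where "S = {y. x \<bullet> y = 0}"
  obtain a b where ab: "a \<noteq> 0 \<or> b \<noteq> 0" "a *\<^sub>R p + b *\<^sub>R q \<in> S"
  proof (cases "x \<bullet> p = 0")
    case True
    then show ?thesis
      using that[of 1 0] by (simp add: S_def)
  next
    case False
    then show ?thesis
      using that[of "x \<bullet> q" "- (x \<bullet> p)"] by (simp add: S_def inner_add_right inner_diff_right)
  qed
  define w where "w = a *\<^sub>R p + b *\<^sub>R q"
  have w: "w \<in> S" "w \<noteq> 0" "w \<bullet> (A *v w) > c * (w \<bullet> w)"
    using ab nz pos by (auto simp: w_def)
  have "subspace S"
    by (simp add: S_def subspace_hyperplane)
  moreover have "(*v) A ` S \<subseteq> S"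
    using x(2) by (auto simp: S_def adj)
  ultimately obtain y \<nu> where y: "y \<in> S" "y \<noteq> 0" "A *v y = \<nu> *\<^sub>R y"
    and y_max: "\<And>z. z \<in> S \<Longrightarrow> z \<bullet> (A *v z) \<le> \<nu> * (z \<bullet> z)"
    using self_adjoint_max_eigenvector[OF lin adj, of S] w by blast
  have "w \<bullet> w > 0"
    using w by simp
  moreover have "c * (w \<bullet> w) < \<mu> * (w \<bullet> w)" "c * (w \<bullet> w) < \<nu> * (w \<bullet> w)"
    using w(3) x_max[of w] y_max[OF w(1)] by linarith+
  ultimately have gt: "c < \<mu>" "c < \<nu>"
    by (meson less_imp_le mult_less_cancel_right_pos)+
  have "x \<noteq> y"
    using x y by (auto simp: S_def)
  moreover have "independent {x, y}"
    using x y \<open>x \<noteq> y\<close>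
    by (intro pairwise_orthogonal_independent)
      (auto simp: pairwise_def orthogonal_def S_def inner_commute)
  ultimately have "[:- \<mu>, 1:] * [:- \<nu>, 1:] dvd characteristic_polynomial A"
    using x y by (intro linear_factors_dvd_characteristic_polynomial) (auto simp: vA)
  then obtain r where r: "characteristic_polynomial A = [:- \<mu>, 1:] * [:- \<nu>, 1:] * r" ..
  \<comment> \<open>Splitting \<open>proots\<close> over a product needs nonzero factors. The point
    \<open>\<mu> + 1\<close> lies above every Rayleigh quotient, hence is no eigenvalue.\<close>
  have "characteristic_polynomial A \<noteq> 0"
  proof
    assume "characteristic_polynomial A = 0"
    then have "det (mat (\<mu> + 1) - A) = 0"
      using poly_characteristic_polynomial[of A "\<mu> + 1"] by simp
    then obtain z where z: "z \<noteq> 0" "(mat (\<mu> + 1) - A) *v z = 0"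
      using invertible_det_nz[of "mat (\<mu> + 1) - A"]
        matrix_left_invertible_ker[of "mat (\<mu> + 1) - A"] invertible_left_inverse by blast
    have "mat (\<mu> + 1) *v z = (\<mu> + 1) *\<^sub>R z"
      by (simp add: vec_eq_iff matrix_vector_mult_def mat_def if_distrib[of "\<lambda>a. a * _"] cong: if_cong)
    then have "A *v z = (\<mu> + 1) *\<^sub>R z"
      using z(2) by (simp add: matrix_vector_mult_diff_rdistrib)
    then have "(\<mu> + 1) * (z \<bullet> z) \<le> \<mu> * (z \<bullet> z)"
      using x_max[of z] by simp
    moreover have "z \<bullet> z > 0"
      using z(1) by simp
    ultimately show False
      by (simp add: algebra_simps)
  qed
  then have "proots (characteristic_polynomial A) = {#\<mu>, \<nu>#} + proots r"
    using r by (auto simp: proots_mult simp del: mult_pCons_left mult_pCons_right)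
  then show ?thesis
    unfolding eigenvalue_list_def using gt by (intro second_largest_gt[of \<mu> \<nu>]) auto
qed

section \<open>Adjacency matrices and edge deletion\<close>

lemma transpose_adjacency_matrix: "transpose (adjacency_matrix E) = adjacency_matrix E"
  by (simp add: transpose_def adjacency_matrix_def insert_commute vec_eq_iff)

lemma inner_adjacency_matrix_delete_edge:
  assumes "{u, v} \<in> E" "u \<noteq> v"
  shows "x \<bullet> (adjacency_matrix (delete_edge E u v) *v y) =
    x \<bullet> (adjacency_matrix E *v y) - (x $ u * y $ v + x $ v * y $ u)"
proof -
  have "adjacency_matrix (delete_edge E u v) *v y =
      adjacency_matrix E *v y - (axis u (y $ v) + axis v (y $ u))"
  proof (rule vec_eq_iff[THEN iffD2, rule_format])
    fix i
    have "adjacency_matrix (delete_edge E u v) $ i $ j * y $ j = adjacency_matrix E $ i $ j * y $ j -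
        ((if j = v then if i = u then y $ j else 0 else 0) +
         (if j = u then if i = v then y $ j else 0 else 0))" for j
      using assms by (auto simp: adjacency_matrix_def delete_edge_def doubleton_eq_iff insert_commute)
    then show "(adjacency_matrix (delete_edge E u v) *v y) $ i =
        (adjacency_matrix E *v y - (axis u (y $ v) + axis v (y $ u))) $ i"
      by (simp add: matrix_vector_mult_def sum_subtractf sum.distrib axis_def)
  qed
  then show ?thesis
    by (simp add: inner_diff_right inner_add_right inner_axis)
qed

theorem theorem2p3:
  fixes E :: "'v::finite set set" and z :: "real^'v" and u v :: 'v and Vpos Vneg :: "'v set"
  assumes "simple_graph E"
    and "is_eigenvector (adjacency_matrix E) z (graph_eigenvalue 2 E)"
    and "Vpos = {w. z $ w > 0}"
    and "Vneg = {w. z $ w < 0}"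
    and "u \<in> Vpos"
    and "v \<in> Vneg"
    and "{u, v} \<in> E"
  shows "graph_eigenvalue 2 (delete_edge E u v) > graph_eigenvalue 2 E"
proof -
  define A where "A = adjacency_matrix E"
  define B where "B = adjacency_matrix (delete_edge E u v)"
  define c where "c = graph_eigenvalue 2 E"
  define p where "p = (\<chi> i. max (z $ i) 0)"
  define q where "q = (\<chi> i. max (- z $ i) 0)"
  have zuv: "z $ u > 0" "z $ v < 0"
    using assms by auto
  then have "u \<noteq> v"
    by auto
  note B = inner_adjacency_matrix_delete_edge[OF \<open>{u, v} \<in> E\<close> this, folded A_def B_def]
  have symB: "transpose B = B"
    unfolding B_def by (rule transpose_adjacency_matrix)
  have sym: "x \<bullet> (A *v y) = y \<bullet> (A *v x)" for x y
    using dot_lmul_matrix[of x A y] transpose_matrix_vector[of A x]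
    by (simp add: A_def transpose_adjacency_matrix inner_commute)
  have z: "z = p - q"
    by (simp add: p_def q_def vec_eq_iff max_def)
  have pq: "p \<bullet> q = 0"
    by (auto simp: p_def q_def inner_vec_def max_def intro!: sum.neutral)
  have nonneg: "p $ i \<ge> 0" "q $ i \<ge> 0" for i
    by (simp_all add: p_def q_def)
  have puv: "p $ u > 0" "q $ v > 0" "p $ v = 0" "q $ u = 0"
    using zuv by (auto simp: p_def q_def)
  have "A *v p - A *v q = c *\<^sub>R p - c *\<^sub>R q"
    using assms(2) by (simp add: is_eigenvector_def A_def c_def z matrix_vector_mult_diff_distrib
        scaleR_diff_right)
  then have eig: "A *v p = A *v q + c *\<^sub>R p - c *\<^sub>R q"
    by (simp add: algebra_simps)
  define s where "s = p \<bullet> (A *v q)"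
  define d where "d = p $ u * q $ v"
  have pAp: "p \<bullet> (A *v p) = s + c * (p \<bullet> p)"
    unfolding eig by (simp add: s_def pq inner_simps)
  have "q \<bullet> (A *v p) = q \<bullet> (A *v q) - c * (q \<bullet> q)"
    unfolding eig by (simp add: pq inner_commute[of q p] inner_simps)
  then have qAq: "q \<bullet> (A *v q) = s + c * (q \<bullet> q)"
    by (simp add: s_def sym[of q p])
  have "d > 0"
    using puv by (simp add: d_def)
  have A_nonneg: "A $ i $ j \<ge> 0" for i j
    by (simp add: A_def adjacency_matrix_def)
  have Aq: "(A *v q) $ i = (\<Sum>j\<in>UNIV. A $ i $ j * q $ j)" for i
    by (simp add: matrix_vector_mult_def)
  have Aq_nonneg: "(A *v q) $ i \<ge> 0" for i
    unfolding Aq by (intro sum_nonneg mult_nonneg_nonneg nonneg A_nonneg)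
  \<comment> \<open>\<open>s\<close> is a sum of nonnegative terms, and the edge \<open>uv\<close>
    contributes \<open>d\<close> to it.\<close>
  have "d \<le> s"
  proof -
    have "q $ v = A $ u $ v * q $ v"
      using assms by (simp add: A_def adjacency_matrix_def)
    also have "\<dots> \<le> (A *v q) $ u"
      unfolding Aq by (rule member_le_sum) (auto intro: mult_nonneg_nonneg nonneg A_nonneg)
    finally have "d \<le> p $ u * (A *v q) $ u"
      unfolding d_def by (intro mult_left_mono nonneg)
    also have "\<dots> \<le> s"
      unfolding s_def inner_vec_def inner_real_def
      by (rule member_le_sum) (auto intro: mult_nonneg_nonneg nonneg Aq_nonneg)
    finally show ?thesis .
  qed
  \<comment> \<open>The form of \<open>A\<close> exceeds \<open>c\<close> times the squared norm by
    \<open>s * (a + b)\<^sup>2\<close>; the deleted edge subtracts \<open>2 * a * b * d\<close>, and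
    completing the square regroups the rest.\<close>
  have form: "(a *\<^sub>R p + b *\<^sub>R q) \<bullet> (B *v (a *\<^sub>R p + b *\<^sub>R q)) =
      c * ((a *\<^sub>R p + b *\<^sub>R q) \<bullet> (a *\<^sub>R p + b *\<^sub>R q)) +
      (d * (a\<^sup>2 + b\<^sup>2) + (s - d) * (a + b)\<^sup>2)" for a b
  proof -
    have "(a *\<^sub>R p + b *\<^sub>R q) \<bullet> (A *v (a *\<^sub>R p + b *\<^sub>R q)) =
        a\<^sup>2 * (p \<bullet> (A *v p)) + 2 * a * b * s + b\<^sup>2 * (q \<bullet> (A *v q))"
      by (simp add: matrix_vector_right_distrib matrix_vector_mult_scaleR inner_add_left
          inner_add_right sym[of q p] s_def power2_eq_square algebra_simps)
    moreover have "(a *\<^sub>R p + b *\<^sub>R q) \<bullet> (a *\<^sub>R p + b *\<^sub>R q) = a\<^sup>2 * (p \<bullet> p) + b\<^sup>2 * (q \<bullet> q)"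
      by (simp add: inner_add_left inner_add_right pq inner_commute[of q p] power2_eq_square)
    moreover have "(a *\<^sub>R p + b *\<^sub>R q) $ u = a * p $ u" "(a *\<^sub>R p + b *\<^sub>R q) $ v = b * q $ v"
      by (simp_all add: puv)
    ultimately show ?thesis
      unfolding B pAp qAq d_def by (simp only:) (simp add: power2_eq_square algebra_simps)
  qed
  have "eigenvalue_list B ! 1 > c"
  proof (rule second_eigenvalue_gt[OF symB])
    fix a b :: real
    assume "a \<noteq> 0 \<or> b \<noteq> 0"
    then have "d * (a\<^sup>2 + b\<^sup>2) > 0"
      using \<open>d > 0\<close> by (simp add: sum_power2_gt_zero_iff)
    moreover have "(s - d) * (a + b)\<^sup>2 \<ge> 0"
      using \<open>d \<le> s\<close> by simp
    ultimately show "(a *\<^sub>R p + b *\<^sub>R q) \<bullet> (B *v (a *\<^sub>R p + b *\<^sub>R q)) >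
        c * ((a *\<^sub>R p + b *\<^sub>R q) \<bullet> (a *\<^sub>R p + b *\<^sub>R q))"
      unfolding form by linarith
  qed
  then show ?thesis
    by (simp add: graph_eigenvalue_def B_def c_def)
qed

end
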